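(* Let $n \ge 10^9$ be an odd integer, let $k$ be an even integer with $\frac{2n}{5} < k < \frac{n}{2}$, and let $G$ be an $n$-vertex $k$-regular graph. If the number of triangles in $G$ is at most $\frac{k}{4}(3k-n-1)$, then $G$ can be made bipartite by deleting at most $\frac{15}{2}k^{3/2}$ edges. *)

theory Defs
  imports Complex_Main
begin

text \<open>Finite simple undirected graphs, given by a vertex set \<open>V\<close> and a set \<open>E\<close> of
  two-element subsets of \<open>V\<close>.\<close>

definition simple_graph :: "'a set \<Rightarrow> 'a set set \<Rightarrow> bool" where
  "simple_graph V E \<longleftrightarrow> finite V \<and> (\<forall>e\<in>E. e \<subseteq> V \<and> card e = 2)"

definition vertex_degree :: "'a set set \<Rightarrow> 'a \<Rightarrow> nat" where
  "vertex_degree E v = card {e \<in> E. v \<in> e}"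

definition regular_graph :: "nat \<Rightarrow> 'a set \<Rightarrow> 'a set set \<Rightarrow> bool" where
  "regular_graph k V E \<longleftrightarrow> simple_graph V E \<and> (\<forall>v\<in>V. vertex_degree E v = k)"

text \<open>A triangle is identified with its set of three vertices, so each one is counted once.\<close>

definition triangles :: "'a set \<Rightarrow> 'a set set \<Rightarrow> 'a set set" where
  "triangles V E =
     {T. T \<subseteq> V \<and> card T = 3 \<and> (\<forall>x\<in>T. \<forall>y\<in>T. x \<noteq> y \<longrightarrow> {x, y} \<in> E)}"

definition bipartite_graph :: "'a set \<Rightarrow> 'a set set \<Rightarrow> bool" where
  "bipartite_graph V E \<longleftrightarrow> simple_graph V E \<and>
     (\<exists>A B. A \<union> B = V \<and> A \<inter> B = {} \<and> (\<forall>e\<in>E. \<exists>a\<in>A. \<exists>b\<in>B. e = {a, b}))"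

end

theory Submission
  imports Defs "HOL-Library.Numeral_Type" "HOL-Library.FuncSet" "HOL-Library.Disjoint_Sets"
    "HOL-Combinatorics.Multiset_Permutations"
begin

text \<open>
  Write \<open>s = \<surd>k\<close>. As there are only \<open>O(k\<^sup>2)\<close> triangles, deleting the edges \<open>xy\<close> of codegree above
  \<open>10 s\<close> and all edges at vertices lying in more than \<open>k s / 4\<close> triangles costs \<open>O(k s)\<close> edges. The
  non-isolated vertices of the remaining graph have degree above \<open>n / 3\<close>, so it is bipartite unless
  it has a closed walk of length 5 (possibly one around a triangle).

  Suppose it has one. Five vertices in cyclic order satisfy \<open>5 k \<le> 2 n + \<Sigma>\<close>, where \<open>\<Sigma>\<close> is the sum of
  the codegrees of consecutive vertices. As the codegrees along the walk are small and \<open>5 k > 2 n\<close>,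
  all but \<open>O(s)\<close> vertices are adjacent to exactly two, non-consecutive, vertices of the walk. This
  makes \<open>G\<close> a blow-up of a pentagon with parts of size \<open>k / 2 + O(s)\<close>, up to \<open>O(k s)\<close> edges. Since
  \<open>k\<close> is even, \<open>5 k - 2 n \<ge> 2\<close>, and averaging the inequality over transversal pentagons of the
  blow-up gives about \<open>k\<^sup>2 / 2\<close> as a lower bound for three times the number of triangles, against
  an upper bound of about \<open>3 k\<^sup>2 / 8\<close>.
\<close>


section \<open>Counting and averaging\<close>

lemma card_greater_mult_le_sum:
  fixes f :: "'a \<Rightarrow> 'b::linordered_idom"
  assumes "finite S" and "\<And>x. x \<in> S \<Longrightarrow> 0 \<le> f x"
  shows "of_nat (card {x \<in> S. t < f x}) * t \<le> sum f S"
proof -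
  have "of_nat (card {x \<in> S. t < f x}) * t = (\<Sum>x | x \<in> S \<and> t < f x. t)" by simp
  also have "\<dots> \<le> (\<Sum>x | x \<in> S \<and> t < f x. f x)" by (intro sum_mono) auto
  also have "\<dots> \<le> sum f S" using assms by (intro sum_mono2) auto
  finally show ?thesis .
qed

lemma sum_PiE_two_coordinates:
  fixes h :: "'a \<Rightarrow> 'a \<Rightarrow> 'b::comm_semiring_1"
  assumes I: "finite I" "i \<in> I" "j \<in> I" "i \<noteq> j" and fin: "\<And>l. l \<in> I \<Longrightarrow> finite (W l)"
  shows "(\<Sum>f\<in>PiE I W. h (f i) (f j))
    = of_nat (\<Prod>l\<in>I - {i, j}. card (W l)) * (\<Sum>x\<in>W i. \<Sum>y\<in>W j. h x y)"
proof -
  let ?fibre = "\<lambda>x y. {f \<in> PiE I W. (f i, f j) = (x, y)}"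
  have card_fibre: "card (?fibre x y) = (\<Prod>l\<in>I - {i, j}. card (W l))"
    if "x \<in> W i" "y \<in> W j" for x y
  proof -
    let ?W' = "W(i := {x}, j := {y})"
    have "?fibre x y = PiE I ?W'"
      using that I by (auto simp: PiE_iff extensional_def split: if_splits)
    then have "card (?fibre x y) = (\<Prod>l\<in>I. card (?W' l))"
      using I by (simp add: card_PiE)
    also have "\<dots> = (\<Prod>l\<in>I - {i, j}. card (W l))"
      using I by (intro prod.mono_neutral_cong_right) auto
    finally show ?thesis .
  qed
  have "(\<Sum>f\<in>PiE I W. h (f i) (f j))
    = (\<Sum>(x, y)\<in>W i \<times> W j. \<Sum>f\<in>?fibre x y. h (f i) (f j))"
    unfolding case_prod_unfold prod.collapse
    using I fin by (intro sum.group[symmetric] finite_PiE) auto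
  also have "\<dots> = (\<Sum>(x, y)\<in>W i \<times> W j. of_nat (\<Prod>l\<in>I - {i, j}. card (W l)) * h x y)"
    using card_fibre by (intro sum.cong) auto
  finally show ?thesis
    by (simp add: sum_distrib_left sum.cartesian_product case_prod_unfold)
qed

text \<open>The random transversal with independent uniform coordinates: two distinct coordinates are
  uniform on \<open>W i \<times> W (\<sigma> i)\<close>.\<close>
lemma transversal_sum_le_sum_densities:
  fixes W :: "'i::finite \<Rightarrow> 'a set" and g :: "'a \<Rightarrow> 'a \<Rightarrow> real"
  assumes fin: "\<And>i. finite (W i)" and nonempty: "\<And>i. W i \<noteq> {}" and \<sigma>: "\<And>i. \<sigma> i \<noteq> i"
    and lower: "\<And>f. (\<And>i. f i \<in> W i) \<Longrightarrow> r \<le> (\<Sum>i\<in>UNIV. g (f i) (f (\<sigma> i)))"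
  shows "r \<le> (\<Sum>i\<in>UNIV. (\<Sum>x\<in>W i. \<Sum>y\<in>W (\<sigma> i). g x y) / (real (card (W i)) * real (card (W (\<sigma> i)))))"
    (is "_ \<le> (\<Sum>i\<in>_. ?G i / ?c i)")
proof -
  let ?total = "real (\<Prod>i\<in>UNIV. card (W i))"
  have card_pos: "0 < card (W i)" for i
    using fin nonempty by (simp add: card_gt_0_iff)
  have pair_average: "(\<Sum>f\<in>PiE UNIV W. g (f i) (f (\<sigma> i))) = ?total * (?G i / ?c i)" for i
  proof -
    have "(\<Prod>l\<in>UNIV. card (W l)) = card (W i) * card (W (\<sigma> i)) * (\<Prod>l\<in>UNIV - {i, \<sigma> i}. card (W l))"
      using \<sigma>[of i] prod.subset_diff[of "{i, \<sigma> i}" UNIV "\<lambda>l. card (W l)"] by simp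
    then show ?thesis
      using \<sigma>[of i] card_pos[of i] card_pos[of "\<sigma> i"] fin by (simp add: sum_PiE_two_coordinates)
  qed
  have "?total * r = (\<Sum>f\<in>PiE UNIV W. r)"
    by (simp add: card_PiE)
  also have "\<dots> \<le> (\<Sum>f\<in>PiE UNIV W. \<Sum>i\<in>UNIV. g (f i) (f (\<sigma> i)))"
    by (intro sum_mono lower) auto
  also have "\<dots> = ?total * (\<Sum>i\<in>UNIV. ?G i / ?c i)"
    by (subst sum.swap) (simp only: pair_average sum_distrib_left)
  finally show ?thesis
    using card_pos by (simp add: mult_le_cancel_left prod_pos)
qed

lemma transversal_sum_mult_square_le:
  fixes W :: "'i::finite \<Rightarrow> 'a set" and g :: "'a \<Rightarrow> 'a \<Rightarrow> real" and m :: real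
  assumes fin: "\<And>i. finite (W i)" and m: "0 < m" "\<And>i. m \<le> card (W i)" and \<sigma>: "\<And>i. \<sigma> i \<noteq> i"
    and nonneg: "\<And>x y. 0 \<le> g x y"
    and lower: "\<And>f. (\<And>i. f i \<in> W i) \<Longrightarrow> r \<le> (\<Sum>i\<in>UNIV. g (f i) (f (\<sigma> i)))"
  shows "r * m\<^sup>2 \<le> (\<Sum>i\<in>UNIV. \<Sum>x\<in>W i. \<Sum>y\<in>W (\<sigma> i). g x y)"
    (is "_ \<le> (\<Sum>i\<in>_. ?G i)")
proof -
  have nonempty: "W i \<noteq> {}" for i
    using m(1) m(2)[of i] by auto
  have "r \<le> (\<Sum>i\<in>UNIV. ?G i / (real (card (W i)) * real (card (W (\<sigma> i)))))"
    by (intro transversal_sum_le_sum_densities fin nonempty \<sigma> lower)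
  also have "\<dots> \<le> (\<Sum>i\<in>UNIV. ?G i / m\<^sup>2)"
  proof (rule sum_mono)
    fix i
    have "0 < m * m" "m * m \<le> real (card (W i)) * real (card (W (\<sigma> i)))"
      using m(1) m(2)[of i] m(2)[of "\<sigma> i"] by (auto intro!: mult_mono)
    moreover have "0 \<le> ?G i" by (intro sum_nonneg nonneg)
    ultimately show "?G i / (real (card (W i)) * real (card (W (\<sigma> i)))) \<le> ?G i / m\<^sup>2"
      unfolding power2_eq_square by (intro frac_le) auto
  qed
  finally show ?thesis
    using m(1) by (simp add: pos_le_divide_eq flip: sum_divide_distrib)
qed

section \<open>Cyclic sequences\<close>

lemma UNIV_5: "(UNIV :: 5 set) = {0, 1, 2, 3, 4}"
proof -
  have "i \<in> {0, 1, 2, 3, 4}" for i :: 5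
  proof (cases i)
    case (of_int z)
    then have "z \<in> {0, 1, 2, 3, 4}" by auto
    then show ?thesis using of_int(1) by auto
  qed
  then show ?thesis by blast
qed

lemma sum_5_shift: "sum f UNIV = f i + f (i + 1) + f (i + 2) + f (i + 3) + f (i + 4)" for i :: 5
proof -
  have "sum f UNIV = (\<Sum>j\<in>UNIV. f (i + j))"
    by (rule sum.reindex_bij_witness[of _ "\<lambda>j. i + j" "\<lambda>j. j - i"]) auto
  also have "\<dots> = f i + f (i + 1) + f (i + 2) + f (i + 3) + f (i + 4)"
    unfolding UNIV_5 by (simp add: add.assoc)
  finally show ?thesis .
qed

lemma relative_position_5:
  fixes i j :: 5
  obtains "j = i" | "j = i + 1" | "j = i - 1" | "i + 1 = j - 1" | "i - 1 = j + 1"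
proof -
  have "j - i \<in> {0, 1, 2, 3, 4}" by (simp flip: UNIV_5)
  then show thesis using that by (auto simp: algebra_simps)
qed

lemma two_card_le_consecutive:
  fixes S :: "'i::finite set"
  assumes "bij \<sigma>"
  shows "2 * card S \<le> CARD('i) + card {i. i \<in> S \<and> \<sigma> i \<in> S}"
proof -
  have "card (\<sigma> -` S) = card S"
    using assms by (intro card_vimage_inj) (auto simp: bij_def)
  then have "2 * card S = card (S \<union> \<sigma> -` S) + card (S \<inter> \<sigma> -` S)"
    using card_Un_Int[of S "\<sigma> -` S"] by simp
  moreover have "card (S \<union> \<sigma> -` S) \<le> CARD('i)"
    by (intro card_mono) auto
  moreover have "S \<inter> \<sigma> -` S = {i. i \<in> S \<and> \<sigma> i \<in> S}"
    by auto
  ultimately show ?thesis by simp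
qed

lemma card_le_half_plus_consecutive:
  fixes S :: "'i::finite set"
  assumes "bij \<sigma>"
  shows "card S \<le> CARD('i) div 2 + card {i. i \<in> S \<and> \<sigma> i \<in> S}"
  using two_card_le_consecutive[OF assms, of S] by linarith

lemma card_le_consecutive_unless_alternating:
  fixes S :: "5 set"
  assumes not_alternating: "\<And>i. S \<noteq> {i - 1, i + 1}"
  shows "card S \<le> 1 + 2 * card {i. i \<in> S \<and> i + 1 \<in> S}"
proof (cases "{i. i \<in> S \<and> i + 1 \<in> S} = {}")
  case True
  have "bij (\<lambda>i::5. i + 1)" by (simp add: bij_plus_right)
  from card_le_half_plus_consecutive[OF this, of S] have "card S \<le> 2"
    unfolding True by simp
  moreover have "card S \<noteq> 2"
  proof
    assume "card S = 2"
    then obtain i j where S: "S = {i, j}" "i \<noteq> j" by (auto simp: card_2_iff)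
    have "\<not> (l \<in> S \<and> l + 1 \<in> S)" for l using True by blast
    moreover have "S \<noteq> {i, i + 1 + 1}" "S \<noteq> {j, j + 1 + 1}"
      using not_alternating[of "i + 1"] not_alternating[of "j + 1"] by simp_all
    ultimately show False
      using S by (cases i j rule: relative_position_5) (auto simp: diff_eq_eq eq_diff_eq)
  qed
  ultimately show ?thesis by linarith
next
  case False
  then have "1 \<le> card {i. i \<in> S \<and> i + 1 \<in> S}" by (simp add: Suc_le_eq card_gt_0_iff)
  then show ?thesis
    using two_card_le_consecutive[of "\<lambda>i. i + 1" S] by (simp add: bij_plus_right)
qed

section \<open>Codegrees and triangles\<close>

definition nbhd :: "'a set set \<Rightarrow> 'a \<Rightarrow> 'a set" where
  "nbhd E x = {y. {x, y} \<in> E}"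

lemma nbhd_commute: "y \<in> nbhd E x \<longleftrightarrow> x \<in> nbhd E y"
  by (simp add: nbhd_def insert_commute)

text \<open>A closed walk of length \<open>n\<close> is indexed by the numeral type \<open>n\<close>, the integers modulo \<open>n\<close>.\<close>
definition closed_walk :: "'a set set \<Rightarrow> ('i::{plus, one} \<Rightarrow> 'a) \<Rightarrow> bool" where
  "closed_walk E p \<longleftrightarrow> (\<forall>i. p (i + 1) \<in> nbhd E (p i))"

lemma closed_5_walkI:
  assumes "b \<in> nbhd E a" "c \<in> nbhd E b" "d \<in> nbhd E c" "e \<in> nbhd E d" "a \<in> nbhd E e"
  shows "\<exists>p :: 5 \<Rightarrow> 'a. closed_walk E p"
proof -
  let ?p = "\<lambda>i :: 5. if i = 0 then a else if i = 1 then b else if i = 2 then c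
    else if i = 3 then d else e"
  have "\<forall>i\<in>UNIV. ?p (i + 1) \<in> nbhd E (?p i)"
    unfolding UNIV_5 using assms by simp
  then show ?thesis
    unfolding closed_walk_def by (intro exI[of _ ?p]) simp
qed

lemma bipartite_graphI:
  assumes "simple_graph V E" and colouring: "\<And>x y. {x, y} \<in> E \<Longrightarrow> (x \<in> P) \<noteq> (y \<in> P)"
  shows "bipartite_graph V E"
proof -
  have "\<exists>a\<in>V \<inter> P. \<exists>b\<in>V - P. e = {a, b}" if e: "e \<in> E" for e
  proof -
    have "card e = 2" "e \<subseteq> V"
      using assms(1) e by (auto simp: simple_graph_def)
    then obtain x y where "e = {x, y}" "x \<in> V" "y \<in> V"
      by (auto simp: card_2_iff)
    moreover have "(x \<in> P) \<noteq> (y \<in> P)"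
      using colouring e \<open>e = {x, y}\<close> by simp
    ultimately show ?thesis by (auto simp: insert_commute)
  qed
  then show ?thesis
    unfolding bipartite_graph_def using assms(1)
    by (intro conjI exI[of _ "V \<inter> P"] exI[of _ "V - P"]) auto
qed

locale graph =
  fixes V :: "'a set" and E :: "'a set set"
  assumes simple: "simple_graph V E"
begin

abbreviation "N \<equiv> nbhd E"

definition codeg :: "'a \<Rightarrow> 'a \<Rightarrow> nat" where
  "codeg x y = card (N x \<inter> N y)"

definition ordered_triangles :: "'a \<Rightarrow> nat" where
  "ordered_triangles x = (\<Sum>y\<in>N x. codeg x y)"

definition triangles_across :: "'a set \<Rightarrow> 'a set \<Rightarrow> nat" where
  "triangles_across P Q = (\<Sum>x\<in>P. \<Sum>y\<in>Q \<inter> N x. codeg x y)"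

lemma finite_V: "finite V"
  using simple by (simp add: simple_graph_def)

lemma adjacentD: "x \<in> V" "y \<in> V" "x \<noteq> y" if "y \<in> N x"
proof -
  have "{x, y} \<subseteq> V" "card {x, y} = 2"
    using simple that by (auto simp: simple_graph_def nbhd_def)
  then show "x \<in> V" "y \<in> V" "x \<noteq> y" by auto
qed

lemma nbhd_subset: "N x \<subseteq> V"
  using adjacentD by blast

lemma finite_nbhd [simp]: "finite (N x)"
  using nbhd_subset finite_V finite_subset by blast

lemma codeg_commute: "codeg x y = codeg y x"
  by (simp add: codeg_def Int_commute)

lemma vertex_degree_eq_card_nbhd: "vertex_degree E x = card (N x)"
proof -
  have "{e \<in> E. x \<in> e} = (\<lambda>y. {x, y}) ` N x"
  proof (intro equalityI subsetI)
    fix e assume e: "e \<in> {e \<in> E. x \<in> e}"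
    then have "card e = 2" using simple by (auto simp: simple_graph_def)
    then show "e \<in> (\<lambda>y. {x, y}) ` N x"
      using e by (auto simp: card_2_iff nbhd_def insert_commute)
  qed (auto simp: nbhd_def)
  moreover have "inj_on (\<lambda>y. {x, y}) (N x)"
    by (auto simp: inj_on_def doubleton_eq_iff)
  ultimately show ?thesis
    by (simp add: vertex_degree_def card_image)
qed

lemma ordered_triangles_eq_permutations:
  "(\<lambda>(x, y, z). [x, y, z]) ` (SIGMA x:V. SIGMA y:N x. N x \<inter> N y)
    = (\<Union>T\<in>triangles V E. permutations_of_set T)" (is "?f ` ?O = ?P")
proof (intro equalityI subsetI)
  fix l assume "l \<in> ?f ` ?O"
  then obtain x y z where l: "l = [x, y, z]" and adj: "y \<in> N x" "z \<in> N x" "z \<in> N y" by auto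
  then have "{x, y, z} \<in> triangles V E"
    using adj[THEN adjacentD(1)] adj[THEN adjacentD(2)] adj[THEN adjacentD(3)]
    by (auto simp: triangles_def nbhd_def insert_commute)
  then show "l \<in> ?P"
    using l adj[THEN adjacentD(3)] by (auto simp: permutations_of_set_def)
next
  fix l assume "l \<in> ?P"
  then have l: "distinct l" "set l \<in> triangles V E"
    by (auto simp: permutations_of_set_def)
  then have "length l = 3"
    by (simp add: triangles_def distinct_card)
  then obtain x y z where "l = [x, y, z]"
    by (auto simp: numeral_3_eq_3 length_Suc_conv)
  then show "l \<in> ?f ` ?O"
    using l by (auto simp: triangles_def nbhd_def image_iff)
qed

lemma sum_ordered_triangles: "sum ordered_triangles V = 6 * card (triangles V E)"
proof -
  let ?O = "SIGMA x:V. SIGMA y:N x. N x \<inter> N y"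
  have finite_triangles: "finite (triangles V E)"
    using finite_V by (auto simp: triangles_def intro: finite_subset[of _ "Pow V"])
  have "sum ordered_triangles V = card ?O"
    using finite_V by (simp add: ordered_triangles_def codeg_def)
  also have "\<dots> = card ((\<lambda>(x, y, z). [x, y, z]) ` ?O)"
    by (rule card_image[symmetric]) (auto simp: inj_on_def)
  also have "\<dots> = (\<Sum>T\<in>triangles V E. card (permutations_of_set T))"
    unfolding ordered_triangles_eq_permutations
    using finite_triangles by (intro card_UN_disjoint) (auto dest: permutations_of_setD)
  also have "\<dots> = (\<Sum>T\<in>triangles V E. 6)"
    by (intro sum.cong) (auto simp: triangles_def fact_numeral card_ge_0_finite)
  finally show ?thesis by simp
qed

lemma triangles_across_commute:
  assumes "finite P" "finite Q"
  shows "triangles_across P Q = triangles_across Q P"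
proof -
  have "triangles_across P Q = (\<Sum>x\<in>P. \<Sum>y | y \<in> Q \<and> y \<in> N x. codeg x y)"
    by (simp add: triangles_across_def Int_def)
  also have "\<dots> = (\<Sum>y\<in>Q. \<Sum>x | x \<in> P \<and> y \<in> N x. codeg x y)"
    using assms by (rule sum.swap_restrict)
  also have "\<dots> = triangles_across Q P"
    by (simp add: triangles_across_def Int_def codeg_commute nbhd_commute[of _ E])
  finally show ?thesis .
qed

lemma triangles_across_add_le:
  assumes "finite Q" "finite R" "Q \<inter> R = {}"
  shows "triangles_across P Q + triangles_across P R \<le> sum ordered_triangles P"
  unfolding triangles_across_def sum.distrib[symmetric]
proof (rule sum_mono)
  fix x
  have "(\<Sum>y\<in>Q \<inter> N x. codeg x y) + (\<Sum>y\<in>R \<inter> N x. codeg x y) = (\<Sum>y\<in>(Q \<inter> N x) \<union> (R \<inter> N x). codeg x y)"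
    using assms by (intro sum.union_disjoint[symmetric]) auto
  also have "\<dots> \<le> ordered_triangles x"
    unfolding ordered_triangles_def by (intro sum_mono2) auto
  finally show "(\<Sum>y\<in>Q \<inter> N x. codeg x y) + (\<Sum>y\<in>R \<inter> N x. codeg x y) \<le> ordered_triangles x" .
qed

lemma two_sum_triangles_across_le:
  fixes W :: "'i::finite \<Rightarrow> 'a set"
  assumes W: "\<And>i. W i \<subseteq> V" "disjoint_family W" and \<sigma>: "bij \<sigma>" "\<And>i. \<sigma> (\<sigma> i) \<noteq> i"
  shows "2 * (\<Sum>i\<in>UNIV. triangles_across (W i) (W (\<sigma> i))) \<le> sum ordered_triangles V"
proof -
  let ?T = "\<lambda>i. triangles_across (W i) (W (\<sigma> i))"
  have fin: "finite (W i)" for i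
    using W(1) finite_V finite_subset by blast
  have reindex: "(\<Sum>i\<in>UNIV. f (\<sigma> i)) = sum f UNIV" for f :: "'i \<Rightarrow> nat"
    using \<sigma>(1) by (rule sum.reindex_bij_betw)
  have two_sides: "?T (\<sigma> i) + ?T i \<le> sum ordered_triangles (W (\<sigma> i))" for i
  proof -
    have "W (\<sigma> (\<sigma> i)) \<inter> W i = {}"
      using W(2) \<sigma>(2)[of i] by (auto simp: disjoint_family_on_def)
    from triangles_across_add_le[OF fin fin this, of "W (\<sigma> i)"] show ?thesis
      using triangles_across_commute[OF fin fin] by simp
  qed
  have "2 * sum ?T UNIV = (\<Sum>i\<in>UNIV. ?T (\<sigma> i) + ?T i)"
    by (simp add: sum.distrib reindex[of ?T])
  also have "\<dots> \<le> (\<Sum>i\<in>UNIV. sum ordered_triangles (W (\<sigma> i)))"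
    by (intro sum_mono two_sides)
  also have "\<dots> = sum ordered_triangles (\<Union>i. W i)"
    using W(2) fin by (subst reindex, subst sum.UNION_disjoint) (auto simp: disjoint_family_on_def)
  also have "\<dots> \<le> sum ordered_triangles V"
    using finite_V W(1) by (intro sum_mono2) auto
  finally show ?thesis .
qed

lemma sum_card_adjacent:
  fixes p :: "'i::finite \<Rightarrow> 'a"
  shows "(\<Sum>v\<in>V. card {i. p i \<in> N v}) = (\<Sum>i\<in>UNIV. card (N (p i)))"
proof -
  have "{v \<in> V. p i \<in> N v} = N (p i)" for i
    using nbhd_subset nbhd_commute[of _ E] by blast
  then show ?thesis
    using sum_multicount_gen[of V "UNIV :: 'i set" "\<lambda>v i. p i \<in> N v"] finite_V by simp
qed

lemma sum_card_both_adjacent: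
  fixes p q :: "'i::finite \<Rightarrow> 'a"
  shows "(\<Sum>v\<in>V. card {i. p i \<in> N v \<and> q i \<in> N v}) = (\<Sum>i\<in>UNIV. codeg (p i) (q i))"
proof -
  have "{v \<in> V. p i \<in> N v \<and> q i \<in> N v} = N (p i) \<inter> N (q i)" for i
    using nbhd_subset nbhd_commute[of _ E] by blast
  then show ?thesis
    using sum_multicount_gen[of V "UNIV :: 'i set" "\<lambda>v i. p i \<in> N v \<and> q i \<in> N v"] finite_V
    by (simp add: codeg_def)
qed

text \<open>Non-adjacent pairs receive weight 2, so that when \<open>5 k - 2 n \<ge> 2\<close> the consecutive pairs of
  any cyclic sequence of five vertices have total weight at least 2, closed walk or not.\<close>
definition weight :: "'a \<Rightarrow> 'a \<Rightarrow> nat" where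
  "weight x y = (if y \<in> N x then codeg x y else 2)"

lemma sum_weight:
  assumes "finite Q"
  shows "(\<Sum>x\<in>P. \<Sum>y\<in>Q. weight x y) = triangles_across P Q + 2 * (\<Sum>x\<in>P. card (Q - N x))"
proof -
  have "(\<Sum>y\<in>Q. weight x y) = (\<Sum>y\<in>Q \<inter> N x. codeg x y) + 2 * card (Q - N x)" for x
    using assms by (simp add: weight_def sum.If_cases Diff_eq)
  then show ?thesis
    by (simp add: triangles_across_def sum.distrib sum_distrib_left)
qed

lemma nbhd_Int_empty_if_no_closed_5_walk:
  assumes no_walk: "\<nexists>p :: 5 \<Rightarrow> 'a. closed_walk E p" and "y \<in> N x"
  shows "N x \<inter> N y = {}"
proof (rule ccontr)
  assume "N x \<inter> N y \<noteq> {}"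
  then obtain z where "z \<in> N x" "z \<in> N y" by blast
  then show False
    using no_walk closed_5_walkI[of y E x z x y] \<open>y \<in> N x\<close> nbhd_commute[of _ E] by blast
qed

lemma common_neighbour_with_edge_end:
  assumes dense: "\<And>x. N x \<noteq> {} \<Longrightarrow> card V < 3 * card (N x)"
    and no_walk: "\<nexists>p :: 5 \<Rightarrow> 'a. closed_walk E p"
    and edge: "v \<in> N u" and "N x \<noteq> {}"
  shows "N x \<inter> N u \<noteq> {} \<or> N x \<inter> N v \<noteq> {}"
proof (rule ccontr)
  assume "\<not> ?thesis"
  then have "card (N x) + card (N u) + card (N v) = card (N x \<union> N u \<union> N v)"
    using nbhd_Int_empty_if_no_closed_5_walk[OF no_walk edge]
    by (simp add: card_Un_disjoint Int_Un_distrib2)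
  also have "\<dots> \<le> card V"
    using nbhd_subset finite_V by (intro card_mono) auto
  finally have "card (N x) + card (N u) + card (N v) \<le> card V" .
  moreover have "N u \<noteq> {}" "N v \<noteq> {}" using edge nbhd_commute[of _ E] by blast+
  ultimately show False
    using dense[of x] dense[of u] dense[of v] \<open>N x \<noteq> {}\<close> by linarith
qed

text \<open>The bipartition is read off a single edge \<open>{u, v}\<close>: one side consists of the vertices having a
  common neighbour with \<open>u\<close>, and every other non-isolated vertex has one with \<open>v\<close>.\<close>
lemma bipartite_if_no_closed_5_walk:
  assumes dense: "\<And>x. N x \<noteq> {} \<Longrightarrow> card V < 3 * card (N x)"
    and no_walk: "\<nexists>p :: 5 \<Rightarrow> 'a. closed_walk E p"
  shows "bipartite_graph V E"
proof (cases "\<exists>u v. v \<in> N u")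
  case False
  then show ?thesis
    using simple by (intro bipartite_graphI[of _ _ "{}"]) (auto simp: nbhd_def)
next
  case True
  then obtain u v where uv: "v \<in> N u" by blast
  note common = common_neighbour_with_edge_end[OF dense no_walk uv]
  show ?thesis
  proof (rule bipartite_graphI[OF simple, of "{x. N x \<inter> N u \<noteq> {}}"])
    fix x y assume "{x, y} \<in> E"
    then have xy: "y \<in> N x" "x \<in> N y" by (auto simp: nbhd_def insert_commute)
    have False if t: "N x \<inter> N t \<noteq> {}" "N y \<inter> N t \<noteq> {}" for t
    proof -
      obtain w w' where "w \<in> N x" "w \<in> N t" "w' \<in> N y" "w' \<in> N t" using t by blast
      then show False
        using no_walk closed_5_walkI[of w E x t w' y] xy nbhd_commute[of _ E] by blast
    qed
    then show "(x \<in> {x. N x \<inter> N u \<noteq> {}}) \<noteq> (y \<in> {x. N x \<inter> N u \<noteq> {}})"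
      using common[of x] common[of y] xy by blast
  qed
qed

end

section \<open>Cyclic sequences of vertices in a regular graph\<close>

locale regular = graph +
  fixes k :: nat
  assumes degree: "v \<in> V \<Longrightarrow> vertex_degree E v = k"
begin

lemma card_nbhd: "x \<in> V \<Longrightarrow> card (N x) = k"
  using degree by (simp add: vertex_degree_eq_card_nbhd)

lemma degree_sum_le_codegree_sum:
  fixes p :: "'i::finite \<Rightarrow> 'a"
  assumes p: "\<And>i. p i \<in> V" and \<sigma>: "bij \<sigma>"
  shows "k * CARD('i) \<le> (CARD('i) div 2) * card V + (\<Sum>i\<in>UNIV. codeg (p i) (p (\<sigma> i)))"
proof -
  have "(\<Sum>v\<in>V. card {i. p i \<in> N v})
    \<le> (\<Sum>v\<in>V. CARD('i) div 2 + card {i. p i \<in> N v \<and> p (\<sigma> i) \<in> N v})"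
    using card_le_half_plus_consecutive[OF \<sigma>, of "{i. p i \<in> N _}"] by (intro sum_mono) simp
  then show ?thesis
    by (simp add: sum.distrib sum_card_adjacent sum_card_both_adjacent card_nbhd[OF p] mult.commute)
qed

lemma two_le_sum_weight:
  fixes q :: "5 \<Rightarrow> 'a"
  assumes q: "\<And>i. q i \<in> V" and dense: "2 * card V + 2 \<le> 5 * k"
  shows "2 \<le> (\<Sum>i\<in>UNIV. weight (q i) (q (i + 1)))"
proof (cases "closed_walk E q")
  case True
  have "k * CARD(5) \<le> (CARD(5) div 2) * card V + (\<Sum>i\<in>UNIV. codeg (q i) (q (i + 1)))"
    using q by (intro degree_sum_le_codegree_sum bij_plus_right)
  moreover have "(\<Sum>i\<in>UNIV. weight (q i) (q (i + 1))) = (\<Sum>i\<in>UNIV. codeg (q i) (q (i + 1)))"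
    using True by (simp add: closed_walk_def weight_def)
  ultimately show ?thesis using dense by simp
next
  case False
  then obtain i where "q (i + 1) \<notin> N (q i)"
    by (auto simp: closed_walk_def)
  then have "2 = weight (q i) (q (i + 1))"
    by (simp add: weight_def)
  also have "\<dots> \<le> (\<Sum>i\<in>UNIV. weight (q i) (q (i + 1)))"
    by (rule member_le_sum) auto
  finally show ?thesis .
qed

end

locale vertex_pentagon = regular +
  fixes p :: "5 \<Rightarrow> 'a"
  assumes p_in_V: "p i \<in> V"
begin

definition part :: "5 \<Rightarrow> 'a set" where
  "part i = {v \<in> V. {j. p j \<in> N v} = {i - 1, i + 1}}"

definition exceptional :: "'a set" where
  "exceptional = V - (\<Union>i. part i)"

lemma part_subset_V: "part i \<subseteq> V"
  by (auto simp: part_def)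

lemma finite_part [simp]: "finite (part i)"
  using part_subset_V finite_V finite_subset by blast

lemma finite_exceptional [simp]: "finite exceptional"
  using finite_V by (simp add: exceptional_def)

lemma part_subset_nbhd: "part i \<subseteq> N (p (i - 1))" "part i \<subseteq> N (p (i + 1))"
  by (auto simp: part_def nbhd_commute[of _ E])

lemma disjoint_family_part: "disjoint_family part"
proof -
  have "i = j" if "{i - 1, i + 1} = {j - 1, j + 1}" for i j :: 5
  proof (rule ccontr)
    assume "i \<noteq> j"
    with that have "i - 1 = j + 1" "i + 1 = j - 1"
      by (auto simp: doubleton_eq_iff)
    then have "(i - 1) + (j - 1) = (j + 1) + (i + 1)" by simp
    then have "(4 :: 5) = 0" by (simp add: algebra_simps)
    then show False by simp
  qed
  then show ?thesis
    by (auto simp: disjoint_family_on_def part_def)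
qed

lemma card_exceptional_le:
  "card exceptional + 5 * k \<le> 2 * card V + 2 * (\<Sum>i\<in>UNIV. codeg (p i) (p (i + 1)))"
proof -
  have pointwise: "of_bool (v \<in> exceptional) + card {i. p i \<in> N v}
    \<le> 2 + 2 * card {i. p i \<in> N v \<and> p (i + 1) \<in> N v}" if v: "v \<in> V" for v
  proof (cases "v \<in> exceptional")
    case True
    then have "{i. p i \<in> N v} \<noteq> {j - 1, j + 1}" for j
      using v by (auto simp: exceptional_def part_def)
    from card_le_consecutive_unless_alternating[OF this] show ?thesis
      using True by simp
  next
    case False
    then obtain i where "{i. p i \<in> N v} = {i - 1, i + 1}"
      using v by (auto simp: exceptional_def part_def)
    then show ?thesis using False by (simp add: card_insert_if)
  qed
  have "V \<inter> exceptional = exceptional"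
    by (auto simp: exceptional_def)
  then have "card exceptional + 5 * k = (\<Sum>v\<in>V. of_bool (v \<in> exceptional) + card {i. p i \<in> N v})"
    using finite_V by (simp add: sum.distrib sum_card_adjacent card_nbhd[OF p_in_V])
  also have "\<dots> \<le> (\<Sum>v\<in>V. 2 + 2 * card {i. p i \<in> N v \<and> p (i + 1) \<in> N v})"
    by (rule sum_mono) (rule pointwise)
  also have "\<dots> = 2 * card V + 2 * (\<Sum>i\<in>UNIV. codeg (p i) (p (i + 1)))"
    unfolding sum.distrib by (simp add: sum_card_both_adjacent flip: sum_distrib_left)
  finally show ?thesis .
qed

lemma card_part_add_le: "card (part (i - 1)) + card (part (i + 1)) \<le> k"
proof -
  have "i + 1 \<noteq> i - 1" by (simp add: algebra_simps)
  then have "card (part (i - 1)) + card (part (i + 1)) = card (part (i - 1) \<union> part (i + 1))"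
    using disjoint_family_part by (simp add: card_Un_disjoint disjoint_family_on_def)
  also have "\<dots> \<le> card (N (p i))"
    using part_subset_nbhd[of "i - 1"] part_subset_nbhd[of "i + 1"] by (intro card_mono) auto
  finally show ?thesis using card_nbhd[OF p_in_V] by simp
qed

lemma card_V_le_card_part: "card V \<le> card exceptional + card (part i) + 2 * k"
proof -
  have "card V \<le> card (exceptional \<union> (\<Union>i. part i))"
    using finite_V by (intro card_mono) (auto simp: exceptional_def)
  also have "\<dots> \<le> card exceptional + (\<Sum>i\<in>UNIV. card (part i))"
    by (intro order_trans[OF card_Un_le] add_mono card_UN_le) auto
  also have "(\<Sum>i\<in>UNIV. card (part i)) \<le> card (part i) + 2 * k"
    using card_part_add_le[of "i + 2"] card_part_add_le[of "i + 3"]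
    unfolding sum_5_shift[of _ i] by (simp add: add.assoc add_diff_eq[symmetric])
  finally show ?thesis by simp
qed

lemma card_part_le: "card (part i) \<le> k"
  using card_part_add_le[of "i + 1"] by simp

lemma card_part_diff_nbhd_le:
  assumes u: "u \<in> part i"
  shows "card (part (i + 1) - N u) \<le> card exceptional + codeg (p (i - 1)) u + codeg (p (i + 1)) u"
proof -
  let ?cover = "(part (i + 1) \<inter> N u) \<union> part (i - 1) \<union> exceptional
    \<union> (N (p (i - 1)) \<inter> N u) \<union> (N (p (i + 1)) \<inter> N u)"
  have "N u \<subseteq> ?cover"
  proof
    fix v assume v: "v \<in> N u"
    show "v \<in> ?cover"
    proof (cases "v \<in> exceptional")
      case False
      then obtain j where j: "v \<in> part j"
        using v nbhd_subset by (auto simp: exceptional_def)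
      note adjacent = subsetD[OF part_subset_nbhd(1) j] subsetD[OF part_subset_nbhd(2) j]
      show ?thesis
      proof (cases i j rule: relative_position_5)
        case 4
        show ?thesis using adjacent v unfolding 4 by simp
      next
        case 5
        show ?thesis using adjacent v unfolding 5 by simp
      qed (use j adjacent v in auto)
    qed simp
  qed
  then have "card (N u) \<le> card ?cover"
    by (intro card_mono) auto
  also have "\<dots> \<le> card (part (i + 1) \<inter> N u) + card (part (i - 1)) + card exceptional
      + card (N (p (i - 1)) \<inter> N u) + card (N (p (i + 1)) \<inter> N u)"
    by (intro order_trans[OF card_Un_le] add_mono order_refl)
  finally have "k \<le> card (part (i + 1) \<inter> N u) + card (part (i - 1)) + card exceptional
      + codeg (p (i - 1)) u + codeg (p (i + 1)) u"
    using card_nbhd[of u] u part_subset_V by (auto simp: codeg_def)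
  moreover have "card (part (i + 1)) = card (part (i + 1) \<inter> N u) + card (part (i + 1) - N u)"
    by (subst card_Un_disjoint[symmetric]) (auto simp: Int_Diff_Un)
  ultimately show ?thesis
    using card_part_add_le[of i] by linarith
qed

lemma sum_card_part_diff_nbhd_le:
  "(\<Sum>u\<in>part i. card (part (i + 1) - N u))
    \<le> k * card exceptional + ordered_triangles (p (i - 1)) + ordered_triangles (p (i + 1))"
proof -
  have "(\<Sum>u\<in>part i. card (part (i + 1) - N u))
    \<le> (\<Sum>u\<in>part i. card exceptional + codeg (p (i - 1)) u + codeg (p (i + 1)) u)"
    by (intro sum_mono card_part_diff_nbhd_le)
  also have "\<dots> = card (part i) * card exceptional + (\<Sum>u\<in>part i. codeg (p (i - 1)) u)
      + (\<Sum>u\<in>part i. codeg (p (i + 1)) u)"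
    by (simp add: sum.distrib)
  also have "\<dots>
    \<le> k * card exceptional + ordered_triangles (p (i - 1)) + ordered_triangles (p (i + 1))"
    unfolding ordered_triangles_def using part_subset_nbhd
    by (intro add_mono mult_right_mono card_part_le sum_mono2) auto
  finally show ?thesis .
qed

lemma two_sum_weight_parts_le:
  "2 * (\<Sum>i\<in>UNIV. \<Sum>x\<in>part i. \<Sum>y\<in>part (i + 1). weight x y)
    \<le> sum ordered_triangles V + 20 * (k * card exceptional)
      + 8 * (\<Sum>i\<in>UNIV. ordered_triangles (p i))"
proof -
  let ?T = "\<lambda>i. ordered_triangles (p i)"
  have shift: "(\<Sum>i\<in>UNIV. ?T (i - 1)) = sum ?T UNIV" "(\<Sum>i\<in>UNIV. ?T (i + 1)) = sum ?T UNIV"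
    by (rule sum.reindex_bij_betw[of _ UNIV UNIV ?T], simp add: bij_diff_right bij_plus_right)+
  have "(\<Sum>i\<in>UNIV. \<Sum>x\<in>part i. \<Sum>y\<in>part (i + 1). weight x y)
    = (\<Sum>i\<in>UNIV. triangles_across (part i) (part (i + 1)))
      + 2 * (\<Sum>i\<in>UNIV. \<Sum>u\<in>part i. card (part (i + 1) - N u))"
    by (simp add: sum_weight sum.distrib sum_distrib_left)
  moreover have "(\<Sum>i\<in>UNIV. \<Sum>u\<in>part i. card (part (i + 1) - N u))
    \<le> (\<Sum>i\<in>UNIV. k * card exceptional + ?T (i - 1) + ?T (i + 1))"
    by (intro sum_mono sum_card_part_diff_nbhd_le)
  moreover have "\<dots> = 5 * (k * card exceptional) + 2 * sum ?T UNIV"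
    by (simp add: sum.distrib shift)
  moreover have "2 * (\<Sum>i\<in>UNIV. triangles_across (part i) (part (i + 1))) \<le> sum ordered_triangles V"
    by (intro two_sum_triangles_across_le part_subset_V disjoint_family_part bij_plus_right)
      (simp add: add.assoc)
  ultimately show ?thesis by linarith
qed

lemma four_square_le_triangles:
  fixes m :: real
  assumes dense: "2 * card V + 2 \<le> 5 * k" and m: "0 < m" "\<And>i. m \<le> card (part i)"
  shows "4 * m\<^sup>2 \<le> sum ordered_triangles V + 20 * (k * card exceptional)
      + 8 * (\<Sum>i\<in>UNIV. ordered_triangles (p i))"
proof -
  have "2 * m\<^sup>2 \<le> (\<Sum>i\<in>UNIV. \<Sum>x\<in>part i. \<Sum>y\<in>part (i + 1). real (weight x y))"
  proof (rule transversal_sum_mult_square_le[OF finite_part m])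
    fix q :: "5 \<Rightarrow> 'a" assume "\<And>i. q i \<in> part i"
    then have "q i \<in> V" for i using part_subset_V by blast
    from of_nat_mono[OF two_le_sum_weight[OF this dense], where ?'a = real]
    show "2 \<le> (\<Sum>i\<in>UNIV. real (weight (q i) (q (i + 1))))" by simp
  qed simp_all
  then show ?thesis
    using of_nat_mono[OF two_sum_weight_parts_le, where ?'a = real] by simp
qed

end

section \<open>Deleting crowded vertices and heavy edges\<close>

locale few_triangles = regular +
  assumes dense: "2 * card V + 2 \<le> 5 * k"
    and sparse: "2 * k \<le> card V"
    and few: "real (card (triangles V E)) \<le> real k / 4 * (3 * real k - real (card V) - 1)"
    and large: "20000 \<le> sqrt (real k)"
begin

abbreviation s :: real where
  "s \<equiv> sqrt (real k)"

definition crowded :: "'a set" where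
  "crowded = {v \<in> V. real k * s / 2 < ordered_triangles v}"

definition heavy_arcs :: "('a \<times> 'a) set" where
  "heavy_arcs = {(x, y). y \<in> N x \<and> 10 * s < codeg x y}"

definition deleted :: "'a set set" where
  "deleted = (\<Union>v\<in>crowded. {e \<in> E. v \<in> e}) \<union> (\<lambda>(x, y). {x, y}) ` heavy_arcs"

lemma sqrt_degree_pos: "0 < s"
  using large by linarith

lemma sqrt_degree_le_degree: "20000 * s \<le> real k"
proof -
  have "20000 * s \<le> s * s" by (rule mult_right_mono[OF large]) simp
  then show ?thesis by simp
qed

lemma sum_ordered_triangles_le:
  "sum ordered_triangles V \<le> 3 / 2 * real k * (3 * real k - real (card V) - 1)"
  using few by (simp add: sum_ordered_triangles)

lemma sum_ordered_triangles_le_square: "sum ordered_triangles V \<le> 3 / 2 * real k * real k"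
proof -
  have "3 / 2 * real k * (3 * real k - real (card V) - 1) \<le> 3 / 2 * real k * real k"
    using sparse by (intro mult_left_mono) auto
  then show ?thesis using sum_ordered_triangles_le by linarith
qed

lemma no_light_pentagon:
  fixes p :: "5 \<Rightarrow> 'a"
  assumes p: "\<And>i. p i \<in> V"
    and light: "\<And>i. codeg (p i) (p (i + 1)) \<le> 10 * s"
    and uncrowded: "\<And>i. ordered_triangles (p i) \<le> k * s / 2"
  shows False
proof -
  interpret vertex_pentagon V E k p
    by unfold_locales (rule p)
  define X where "X = real (card exceptional)"
  define m where "m = real k / 2 - 100 * s"
  have "(\<Sum>i\<in>UNIV. real (codeg (p i) (p (i + 1)))) \<le> (\<Sum>i\<in>(UNIV :: 5 set). 10 * s)"
    by (intro sum_mono light)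
  then have X: "0 \<le> X" "X + 5 * k \<le> 2 * real (card V) + 100 * s"
    using of_nat_mono[OF card_exceptional_le, where ?'a = real] by (simp_all add: X_def)
  then have X_le: "X \<le> 100 * s" using dense by linarith
  have m: "0 < m" using sqrt_degree_le_degree sqrt_degree_pos by (simp add: m_def)
  have m_le: "m \<le> card (part i)" for i
    using card_V_le_card_part[of i] X X_le unfolding m_def X_def by linarith
  have triangles: "sum ordered_triangles V \<le> 3 / 4 * (real k * real k) + 75 * (k * s)"
  proof -
    have "3 / 2 * real k * (3 * real k - real (card V) - 1)
      \<le> 3 / 2 * real k * (real k / 2 + 50 * s)"
      using X by (intro mult_left_mono) auto
    then show ?thesis using sum_ordered_triangles_le by (simp add: algebra_simps)
  qed
  have "(\<Sum>i\<in>UNIV. real (ordered_triangles (p i))) \<le> (\<Sum>i\<in>(UNIV :: 5 set). k * s / 2)"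
    by (intro sum_mono uncrowded)
  moreover have "k * X \<le> k * (100 * s)" using X_le by (rule mult_left_mono) simp
  ultimately have "4 * m\<^sup>2 \<le> 3 / 4 * (real k * real k) + 2095 * (k * s)"
    using four_square_le_triangles[OF dense m m_le] triangles by (simp add: X_def)
  moreover have "m\<^sup>2 = real k * real k / 4 - 100 * (k * s) + 10000 * k"
    by (simp add: m_def power2_eq_square algebra_simps)
  ultimately have "real k * real k \<le> 9980 * (k * s)" by simp
  moreover have "k * (20000 * s) \<le> real k * real k"
    by (intro mult_left_mono sqrt_degree_le_degree) simp
  moreover have "0 < k * s" using sqrt_degree_pos by simp
  ultimately show False by simp
qed

lemma finite_crowded: "finite crowded"
  using finite_V by (simp add: crowded_def)

lemma card_crowded_le: "card crowded \<le> 3 * s"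
proof -
  have "card crowded * (k * s / 2) \<le> (\<Sum>v\<in>V. real (ordered_triangles v))"
    unfolding crowded_def using finite_V by (intro card_greater_mult_le_sum) auto
  also have "\<dots> \<le> 3 / 2 * real k * (s * s)"
    using sum_ordered_triangles_le_square by simp
  also have "\<dots> = (3 * s) * (k * s / 2)"
    by (simp only: times_divide_eq_left times_divide_eq_right mult_ac)
  finally show ?thesis using sqrt_degree_pos by (simp add: mult_le_cancel_right)
qed

lemma card_heavy_nbhd_le: "card {y \<in> N x. 10 * s < codeg x y} * (10 * s) \<le> ordered_triangles x"
  using card_greater_mult_le_sum[of "N x" "\<lambda>y. real (codeg x y)" "10 * s"]
  by (simp add: ordered_triangles_def)

lemma heavy_arcs_eq_Sigma: "heavy_arcs = (SIGMA x:V. {y \<in> N x. 10 * s < codeg x y})"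
  using adjacentD by (auto simp: heavy_arcs_def)

lemma finite_heavy_arcs: "finite heavy_arcs"
  using finite_V by (auto simp: heavy_arcs_eq_Sigma)

lemma card_heavy_arcs_le: "card heavy_arcs \<le> 3 / 20 * k * s"
proof -
  have "card heavy_arcs * (10 * s) = (\<Sum>x\<in>V. card {y \<in> N x. 10 * s < codeg x y} * (10 * s))"
    using finite_V by (simp add: heavy_arcs_eq_Sigma sum_distrib_right)
  also have "\<dots> \<le> (\<Sum>x\<in>V. real (ordered_triangles x))"
    by (intro sum_mono card_heavy_nbhd_le)
  also have "\<dots> \<le> (3 / 20 * k * s) * (10 * s)"
    using sum_ordered_triangles_le_square by simp
  finally show ?thesis using sqrt_degree_pos by (simp only: mult_le_cancel_right_pos)
qed

lemma deleted_subset: "deleted \<subseteq> E"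
  by (auto simp: deleted_def heavy_arcs_def nbhd_def)

lemma card_deleted_le: "card deleted \<le> 15 / 2 * real k powr (3 / 2)"
proof -
  have "card (\<Union>v\<in>crowded. {e \<in> E. v \<in> e}) \<le> (\<Sum>v\<in>crowded. vertex_degree E v)"
    unfolding vertex_degree_def by (rule card_UN_le[OF finite_crowded])
  also have "\<dots> = card crowded * k"
    using degree by (simp add: crowded_def)
  finally have "card deleted \<le> card crowded * k + card heavy_arcs"
    unfolding deleted_def
    by (intro order_trans[OF card_Un_le] add_mono card_image_le finite_heavy_arcs)
  then have "real (card deleted) \<le> card crowded * real k + card heavy_arcs"
    by (metis of_nat_add of_nat_le_iff of_nat_mult)
  also have "\<dots> \<le> 3 * s * k + 3 / 20 * k * s"
    by (intro add_mono mult_right_mono card_crowded_le card_heavy_arcs_le) simp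
  also have "\<dots> \<le> 15 / 2 * (k * s)"
    using sqrt_degree_pos by (simp add: field_simps)
  also have "k * s = real k powr (3 / 2)"
    using powr_add[of "real k" 1 "1 / 2"] by (simp add: powr_half_sqrt)
  finally show ?thesis .
qed

lemma nbhd_remaining_iff:
  "y \<in> nbhd (E - deleted) x
    \<longleftrightarrow> y \<in> N x \<and> codeg x y \<le> 10 * s \<and> x \<notin> crowded \<and> y \<notin> crowded"
  by (auto simp: nbhd_def deleted_def heavy_arcs_def doubleton_eq_iff insert_commute codeg_commute
      not_less)

lemma card_nbhd_remaining_ge:
  assumes x: "x \<in> V" "x \<notin> crowded"
  shows "9 / 10 * k \<le> card (nbhd (E - deleted) x)"
proof -
  let ?R = "nbhd (E - deleted) x" and ?H = "{y \<in> N x. 10 * s < codeg x y}"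
  have "?R \<subseteq> N x" by (auto simp: nbhd_remaining_iff)
  then have "finite ?R" by (rule finite_subset) simp
  have "k = card (N x)" using card_nbhd x(1) by simp
  also have "\<dots> \<le> card (?R \<union> ?H \<union> crowded)"
    using x \<open>finite ?R\<close> finite_crowded by (intro card_mono) (auto simp: nbhd_remaining_iff)
  also have "\<dots> \<le> card ?R + card ?H + card crowded"
    by (intro order_trans[OF card_Un_le] add_mono order_refl)
  finally have "real k \<le> card ?R + card ?H + card crowded" by linarith
  moreover have "card ?H * (10 * s) \<le> (k / 20) * (10 * s)"
    using card_heavy_nbhd_le[of x] x by (simp add: crowded_def)
  then have "card ?H \<le> real k / 20"
    using sqrt_degree_pos by (simp only: mult_le_cancel_right_pos)
  moreover have "3 * s \<le> real k / 20"
    using sqrt_degree_le_degree sqrt_degree_pos by linarith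
  ultimately show ?thesis using card_crowded_le by linarith
qed

lemma bipartite_remaining: "bipartite_graph V (E - deleted)"
proof -
  interpret R: graph V "E - deleted"
    using simple by unfold_locales (auto simp: simple_graph_def)
  show ?thesis
  proof (rule R.bipartite_if_no_closed_5_walk)
    fix x assume "R.N x \<noteq> {}"
    then have "x \<in> V" "x \<notin> crowded" using R.adjacentD by (auto simp: nbhd_remaining_iff)
    moreover have "real (card V) < 27 / 10 * k" using dense by linarith
    ultimately show "card V < 3 * card (R.N x)"
      using card_nbhd_remaining_ge[of x] by linarith
  next
    show "\<nexists>p :: 5 \<Rightarrow> 'a. closed_walk (E - deleted) p"
    proof
      assume "\<exists>p :: 5 \<Rightarrow> 'a. closed_walk (E - deleted) p"
      then obtain p :: "5 \<Rightarrow> 'a" where p: "p (i + 1) \<in> R.N (p i)" for i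
        by (auto simp: closed_walk_def)
      then show False
        using adjacentD
        by (intro no_light_pentagon[of p])
          (auto simp: nbhd_remaining_iff crowded_def not_less)
    qed
  qed
qed

end

theorem theorem3p1:
  fixes V :: "'a set" and E :: "'a set set" and n k :: nat
  assumes "n \<ge> 10 ^ 9" and "odd n"
    and "even k" and "2 * real n / 5 < real k" and "real k < real n / 2"
    and "card V = n" and "regular_graph k V E"
    and "real (card (triangles V E)) \<le> real k / 4 * (3 * real k - real n - 1)"
  shows "\<exists>D. D \<subseteq> E \<and> real (card D) \<le> 15 / 2 * real k powr (3 / 2) \<and>
           bipartite_graph V (E - D)"
proof -
  interpret few_triangles V E k
  proof unfold_locales
    have "2 * n < 5 * k" using assms(4) by linarith
    with \<open>even k\<close> have "2 * n + 2 \<le> 5 * k" by presburger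
    then show "2 * card V + 2 \<le> 5 * k" using \<open>card V = n\<close> by simp
    have "20000\<^sup>2 \<le> real k" using assms(1,4) by simp
    then show "20000 \<le> sqrt (real k)" by (rule real_le_rsqrt)
  qed (use assms in \<open>simp_all add: regular_graph_def\<close>)
  show ?thesis
    using deleted_subset card_deleted_le bipartite_remaining by blast
qed

end
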